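(* Let $p, T_1, T\in\mathbb{N}$ with $p\le T_1<T$, and let $\bm{X}_T=(X_1,\dots,X_T)$ be an order-$p$ parametric autoregressive time series with parameter space $\mathbb{T}$, as described in the context. Let $\mathbb{T}_0\subset\mathbb{T}$ be a (nonempty) null parameter set. Let $\hat\Theta_T=\hat\theta(X_1,\dots,X_{T_1})$ for an arbitrary (measurable) function $\hat\theta:\mathbb{X}^{T_1}\to\mathbb{T}$, and for $\theta\in\mathbb{T}$ put $$R_T(\theta)=\frac{L(\hat\Theta_T;\bm{X}_T)}{L(\theta;\bm{X}_T)},\qquad L(\theta;\bm{X}_T)=\prod_{t=T_1+1}^{T} f\left(X_t\mid X_{t-p},\dots,X_{t-1};\theta\right).$$ Let $\tilde\Theta_T$ be a (measurable) estimator, computed from $\bm{X}_T$, such that $$\tilde\Theta_T\in\left\{\tilde\theta\in\mathbb{T}_0: L(\tilde\theta;\bm{X}_T)\ge L(\theta;\bm{X}_T)\ \text{for all }\theta\in\mathbb{T}_0\right\},$$ and define $S_T=R_T(\tilde\Theta_T)$ and $P_T=1/S_T$. Then for every $\alpha\in(0,1)$, $$\sup_{\theta\in\mathbb{T}_0}\mathrm{Pr}_{\theta}\left(P_T\le\alpha\right)\le\alpha.$$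
   Context: Setting. $\mathbb{X}$ is a measurable space with a $\sigma$-finite reference measure, written $\mathrm{d}x$; $\mathbb{T}$ is a measurable parameter space. For each $\theta\in\mathbb{T}$ there are given a probability density function (PDF) $f(x_1,\dots,x_p;\theta)$ on $\mathbb{X}^p$ (with respect to the product reference measure) and a conditional PDF $f(x\mid z;\theta)\ge 0$, $x\in\mathbb{X}$, $z\in\mathbb{X}^p$, with $\int_{\mathbb{X}} f(x\mid z;\theta)\,\mathrm{d}x=1$ for every $z\in\mathbb{X}^p$. The densities are jointly measurable in all arguments, including $\theta$. $\mathrm{Pr}_\theta$ denotes the probability measure under which $(X_1,\dots,X_p)$ has PDF $f(\cdot;\theta)$ and, for each $t>p$, the conditional law of $X_t$ given $\mathcal{F}_{t-1}=\sigma(X_1,\dots,X_{t-1})$ has PDF $f(\cdot\mid X_{t-p},\dots,X_{t-1};\theta)$. Equivalently, $\bm{X}_T$ has joint PDF $$f(x_1,\dots,x_p;\theta)\prod_{t=p+1}^{T} f(x_t\mid x_{t-p},\dots,x_{t-1};\theta).$$ Conventions: a likelihood ratio with zero denominator is assigned the value $+\infty$ (for $R_T(\theta)$ this happens with $\mathrm{Pr}_\theta$-probability zero); $1/0=+\infty$ and $1/(+\infty)=0$ in the definition of $P_T$. *)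

theory Defs
  imports "HOL-Probability.Probability"
begin

text \<open>
  Points of the \<open>n\<close>-fold power of the observation space are functions that are extensional on
  \<open>{1..n}\<close>, i.e. elements of \<open>space (PiM {1..n} (\<lambda>_. M))\<close>; coordinate \<open>t\<close> is the observation at
  time \<open>t\<close>. The parameter space is \<open>space N\<close>.
\<close>

locale autoregressive_densities = sigma_finite_measure M
  for M :: "'a measure" +
  fixes N :: "'b measure"
    and p :: nat
    and f\<^sub>0 :: "(nat \<Rightarrow> 'a) \<Rightarrow> 'b \<Rightarrow> real"
    and f :: "'a \<Rightarrow> (nat \<Rightarrow> 'a) \<Rightarrow> 'b \<Rightarrow> real"
  assumes initial_measurable:
      "(\<lambda>(x, \<theta>). f\<^sub>0 x \<theta>) \<in> borel_measurable (PiM {1..p} (\<lambda>_. M) \<Otimes>\<^sub>M N)"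
    and initial_nonneg:
      "\<And>\<theta> x. \<lbrakk>\<theta> \<in> space N; x \<in> space (PiM {1..p} (\<lambda>_. M))\<rbrakk> \<Longrightarrow> 0 \<le> f\<^sub>0 x \<theta>"
    and initial_integral:
      "\<And>\<theta>. \<theta> \<in> space N \<Longrightarrow> (\<integral>\<^sup>+x. ennreal (f\<^sub>0 x \<theta>) \<partial>PiM {1..p} (\<lambda>_. M)) = 1"
    and conditional_measurable:
      "(\<lambda>(x, z, \<theta>). f x z \<theta>) \<in> borel_measurable (M \<Otimes>\<^sub>M PiM {1..p} (\<lambda>_. M) \<Otimes>\<^sub>M N)"
    and conditional_nonneg:
      "\<And>\<theta> x z. \<lbrakk>\<theta> \<in> space N; x \<in> space M; z \<in> space (PiM {1..p} (\<lambda>_. M))\<rbrakk> \<Longrightarrow> 0 \<le> f x z \<theta>"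
    and conditional_integral:
      "\<And>\<theta> z. \<lbrakk>\<theta> \<in> space N; z \<in> space (PiM {1..p} (\<lambda>_. M))\<rbrakk>
        \<Longrightarrow> (\<integral>\<^sup>+x. ennreal (f x z \<theta>) \<partial>M) = 1"

text \<open>
  For \<open>t > p\<close>, \<open>lags p x t\<close> is the tuple \<open>(x\<^bsub>t-p\<^esub>, \<dots>, x\<^bsub>t-1\<^esub>)\<close>, reindexed by \<open>{1..p}\<close>.
\<close>

definition lags :: "nat \<Rightarrow> (nat \<Rightarrow> 'a) \<Rightarrow> nat \<Rightarrow> (nat \<Rightarrow> 'a)" where
  "lags p x t = (\<lambda>i\<in>{1..p}. x (t - p + i - 1))"

definition joint_density ::
    "nat \<Rightarrow> ((nat \<Rightarrow> 'a) \<Rightarrow> 'b \<Rightarrow> real) \<Rightarrow> ('a \<Rightarrow> (nat \<Rightarrow> 'a) \<Rightarrow> 'b \<Rightarrow> real)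
      \<Rightarrow> nat \<Rightarrow> 'b \<Rightarrow> (nat \<Rightarrow> 'a) \<Rightarrow> real" where
  "joint_density p f\<^sub>0 f T \<theta> x =
    f\<^sub>0 (restrict x {1..p}) \<theta> * (\<Prod>t = p + 1..T. f (x t) (lags p x t) \<theta>)"

definition observations :: "(nat \<Rightarrow> 'w \<Rightarrow> 'a) \<Rightarrow> nat \<Rightarrow> 'w \<Rightarrow> (nat \<Rightarrow> 'a)" where
  "observations X T \<omega> = (\<lambda>t\<in>{1..T}. X t \<omega>)"

text \<open>
  Only the measurable structure of \<open>\<Omega>\<close> is relevant; it is shared by all the measures \<open>Pr \<theta>\<close>.
\<close>

locale autoregressive_series = autoregressive_densities M N p f\<^sub>0 f
  for M :: "'a measure" and N :: "'b measure" and p :: nat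
    and f\<^sub>0 :: "(nat \<Rightarrow> 'a) \<Rightarrow> 'b \<Rightarrow> real"
    and f :: "'a \<Rightarrow> (nat \<Rightarrow> 'a) \<Rightarrow> 'b \<Rightarrow> real" +
  fixes T :: nat
    and \<Omega> :: "'w measure"
    and Pr :: "'b \<Rightarrow> 'w measure"
    and X :: "nat \<Rightarrow> 'w \<Rightarrow> 'a"
  assumes prob_space_Pr: "\<And>\<theta>. \<theta> \<in> space N \<Longrightarrow> prob_space (Pr \<theta>)"
    and sets_Pr: "\<And>\<theta>. \<theta> \<in> space N \<Longrightarrow> sets (Pr \<theta>) = sets \<Omega>"
    and distributed_observations:
      "\<And>\<theta>. \<theta> \<in> space N \<Longrightarrow>
        distributed (Pr \<theta>) (PiM {1..T} (\<lambda>_. M)) (observations X T)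
          (\<lambda>x. ennreal (joint_density p f\<^sub>0 f T \<theta> x))"

definition likelihood ::
    "nat \<Rightarrow> ('a \<Rightarrow> (nat \<Rightarrow> 'a) \<Rightarrow> 'b \<Rightarrow> real) \<Rightarrow> nat \<Rightarrow> nat \<Rightarrow> 'b \<Rightarrow> (nat \<Rightarrow> 'a) \<Rightarrow> real" where
  "likelihood p f T\<^sub>1 T \<theta> x = (\<Prod>t = T\<^sub>1 + 1..T. f (x t) (lags p x t) \<theta>)"

text \<open>
  A ratio with zero denominator is infinite even if the numerator vanishes, whereas \<open>0 / 0 = 0\<close>
  on \<^typ>\<open>ennreal\<close>; hence the explicit case distinction.
\<close>

definition likelihood_ratio ::
    "nat \<Rightarrow> ('a \<Rightarrow> (nat \<Rightarrow> 'a) \<Rightarrow> 'b \<Rightarrow> real) \<Rightarrow> nat \<Rightarrow> nat \<Rightarrow> ((nat \<Rightarrow> 'a) \<Rightarrow> 'b)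
      \<Rightarrow> 'b \<Rightarrow> (nat \<Rightarrow> 'a) \<Rightarrow> ennreal" where
  "likelihood_ratio p f T\<^sub>1 T \<theta>hat \<theta> x =
    (if likelihood p f T\<^sub>1 T \<theta> x = 0 then \<infinity>
     else ennreal (likelihood p f T\<^sub>1 T (\<theta>hat (restrict x {1..T\<^sub>1})) x
            / likelihood p f T\<^sub>1 T \<theta> x))"

definition split_statistic ::
    "nat \<Rightarrow> ('a \<Rightarrow> (nat \<Rightarrow> 'a) \<Rightarrow> 'b \<Rightarrow> real) \<Rightarrow> nat \<Rightarrow> nat \<Rightarrow> ((nat \<Rightarrow> 'a) \<Rightarrow> 'b)
      \<Rightarrow> ((nat \<Rightarrow> 'a) \<Rightarrow> 'b) \<Rightarrow> (nat \<Rightarrow> 'a) \<Rightarrow> ennreal" where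
  "split_statistic p f T\<^sub>1 T \<theta>hat \<theta>tilde x = likelihood_ratio p f T\<^sub>1 T \<theta>hat (\<theta>tilde x) x"

text \<open>On \<^typ>\<open>ennreal\<close>, \<open>1 / 0 = \<infinity>\<close> and \<open>1 / \<infinity> = 0\<close>.\<close>

definition p_value ::
    "nat \<Rightarrow> ('a \<Rightarrow> (nat \<Rightarrow> 'a) \<Rightarrow> 'b \<Rightarrow> real) \<Rightarrow> nat \<Rightarrow> nat \<Rightarrow> ((nat \<Rightarrow> 'a) \<Rightarrow> 'b)
      \<Rightarrow> ((nat \<Rightarrow> 'a) \<Rightarrow> 'b) \<Rightarrow> (nat \<Rightarrow> 'a) \<Rightarrow> ennreal" where
  "p_value p f T\<^sub>1 T \<theta>hat \<theta>tilde x = 1 / split_statistic p f T\<^sub>1 T \<theta>hat \<theta>tilde x"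

end

theory Submission
  imports Defs
begin

text \<open>
  If the true parameter \<open>\<theta>\<close> lies in \<open>\<Theta>\<^sub>0\<close>, then \<open>L \<theta>\<close> is at most the maximised likelihood, so the
  event \<open>P \<le> \<alpha>\<close> is contained in \<open>L \<theta> \<le> \<alpha> * L \<theta>hat\<close>. On the latter event the joint density at \<open>\<theta>\<close> is at
  most \<open>\<alpha>\<close> times the function obtained from it by replacing \<open>\<theta>\<close> with \<open>\<theta>hat\<close> in the factors after
  \<open>T\<^sub>1\<close>. Since \<open>\<theta>hat\<close> depends only on the past of these factors, that function is again a probability
  density, by integrating out the coordinates from the last to the first.
\<close>

section \<open>Lags and restrictions of paths\<close>

lemma measurable_lags:
  assumes "p < t" "t \<le> Suc n"
  shows "(\<lambda>x. lags p x t) \<in> measurable (PiM {1..n} (\<lambda>_. M)) (PiM {1..p} (\<lambda>_. M))"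
  unfolding lags_def
  by (intro measurable_restrict measurable_component_singleton) (use assms in auto)

lemma measurable_restrict_atLeastAtMost:
  "m \<le> n \<Longrightarrow> (\<lambda>x. restrict x {1..m}) \<in> measurable (PiM {1..n::nat} (\<lambda>_. M)) (PiM {1..m} (\<lambda>_. M))"
  by (intro measurable_restrict_subset) auto

lemma restrict_fun_upd_outside: "t \<notin> A \<Longrightarrow> restrict (x(t := y)) A = restrict x A"
  by (auto simp: fun_eq_iff)

text \<open>For p < t the indices read by \<open>lags p x t\<close> are t - p, ..., t - 1, all below
  t \<le> s. For p \<ge> t the subtraction on naturals would truncate at 0 and the tuple could reach
  s.\<close>

lemma lags_fun_upd: "p < t \<Longrightarrow> t \<le> s \<Longrightarrow> lags p (x(s := y)) t = lags p x t"
  by (auto simp: lags_def fun_eq_iff)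

section \<open>Densities: measurability, sign and total mass\<close>

context autoregressive_densities
begin

lemma initial_density_measurable:
  assumes "\<theta> \<in> space N" "p \<le> n"
  shows "(\<lambda>x. f\<^sub>0 (restrict x {1..p}) \<theta>) \<in> borel_measurable (PiM {1..n} (\<lambda>_. M))"
proof -
  have "(\<lambda>x. (restrict x {1..p}, \<theta>))
      \<in> measurable (PiM {1..n} (\<lambda>_. M)) (PiM {1..p} (\<lambda>_. M) \<Otimes>\<^sub>M N)"
    using assms by (intro measurable_Pair measurable_restrict_atLeastAtMost) auto
  from measurable_compose[OF this initial_measurable] show ?thesis by simp
qed

text \<open>The parameter is a measurable function of the path, so that one lemma serves both a
  fixed \<theta> and the plug-in estimator. Joint measurability of \<open>f\<close> in all its
  arguments makes the composition measurable.\<close>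

lemma conditional_density_measurable:
  assumes "p < t" "t \<le> n" "\<eta> \<in> measurable (PiM {1..n} (\<lambda>_. M)) N"
  shows "(\<lambda>x. f (x t) (lags p x t) (\<eta> x)) \<in> borel_measurable (PiM {1..n} (\<lambda>_. M))"
proof -
  have "(\<lambda>x. (x t, lags p x t, \<eta> x))
      \<in> measurable (PiM {1..n} (\<lambda>_. M)) (M \<Otimes>\<^sub>M PiM {1..p} (\<lambda>_. M) \<Otimes>\<^sub>M N)"
    using assms by (intro measurable_Pair measurable_lags measurable_component_singleton) auto
  from measurable_compose[OF this conditional_measurable] show ?thesis by simp
qed

lemma conditional_density_nonneg:
  assumes "\<theta> \<in> space N" "x \<in> space (PiM {1..n} (\<lambda>_. M))" "p < t" "t \<le> n"
  shows "0 \<le> f (x t) (lags p x t) \<theta>"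
proof (rule conditional_nonneg)
  show "x t \<in> space M"
    using assms by (auto simp: space_PiM)
  show "lags p x t \<in> space (PiM {1..p} (\<lambda>_. M))"
    using measurable_space[OF measurable_lags] assms by (metis le_SucI)
qed (fact assms)

lemma likelihood_measurable:
  assumes "p \<le> m" "\<eta> \<in> measurable (PiM {1..n} (\<lambda>_. M)) N"
  shows "(\<lambda>x. likelihood p f m n (\<eta> x) x) \<in> borel_measurable (PiM {1..n} (\<lambda>_. M))"
  unfolding likelihood_def
  using assms by (intro borel_measurable_prod conditional_density_measurable) auto

lemma likelihood_nonneg:
  assumes "p \<le> m" "\<theta> \<in> space N" "x \<in> space (PiM {1..n} (\<lambda>_. M))"
  shows "0 \<le> likelihood p f m n \<theta> x"
  unfolding likelihood_def
  using assms by (intro prod_nonneg ballI conditional_density_nonneg) auto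

text \<open>The parameter at time t is predictable: it reads only coordinates before t. It is
  therefore constant while coordinate t is integrated, and the conditional density at t contributes
  mass 1. Letting \<eta> vary with t makes a change of parameter midway a special case.\<close>

lemma nn_integral_predictive_density:
  assumes \<theta>: "\<theta> \<in> space N" and "p \<le> n"
    and \<eta>: "\<And>t. p < t \<Longrightarrow> \<eta> t \<in> measurable (PiM {1..t - 1} (\<lambda>_. M)) N"
  shows "(\<integral>\<^sup>+x. ennreal (f\<^sub>0 (restrict x {1..p}) \<theta>)
      * (\<Prod>t = p + 1..n. ennreal (f (x t) (lags p x t) (\<eta> t (restrict x {1..t - 1}))))
      \<partial>PiM {1..n} (\<lambda>_. M)) = 1" (is "integral\<^sup>N _ (?q n) = 1")
  using \<open>p \<le> n\<close>
proof (induction n rule: dec_induct)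
  case base
  have "integral\<^sup>N (PiM {1..p} (\<lambda>_. M)) (?q p) = (\<integral>\<^sup>+x. ennreal (f\<^sub>0 x \<theta>) \<partial>PiM {1..p} (\<lambda>_. M))"
    by (intro nn_integral_cong) (auto simp: space_PiM PiE_restrict)
  then show ?case
    using initial_integral[OF \<theta>] by simp
next
  case (step n)
  interpret product_sigma_finite "\<lambda>_::nat. M" ..
  have q_measurable: "?q (Suc n) \<in> borel_measurable (PiM {1..Suc n} (\<lambda>_. M))"
  proof (intro borel_measurable_times_ennreal borel_measurable_prod_ennreal
      measurable_compose[OF _ measurable_ennreal])
    fix t assume t: "t \<in> {p + 1..Suc n}"
    have "(\<lambda>x. \<eta> t (restrict x {1..t - 1})) \<in> measurable (PiM {1..Suc n} (\<lambda>_. M)) N"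
      using t by (intro measurable_compose[OF measurable_restrict_atLeastAtMost \<eta>]) auto
    then show "(\<lambda>x. f (x t) (lags p x t) (\<eta> t (restrict x {1..t - 1})))
        \<in> borel_measurable (PiM {1..Suc n} (\<lambda>_. M))"
      using t by (intro conditional_density_measurable) auto
  qed (rule initial_density_measurable[OF \<theta>], use step in simp)
  have insert_eq: "{1..Suc n} = insert (Suc n) {1..n}"
    by auto
  \<comment> \<open>Tonelli: the newest coordinate is integrated innermost, with the first n held
    fixed.\<close>
  have "integral\<^sup>N (PiM {1..Suc n} (\<lambda>_. M)) (?q (Suc n))
      = (\<integral>\<^sup>+x. \<integral>\<^sup>+y. ?q (Suc n) (x(Suc n := y)) \<partial>M \<partial>PiM {1..n} (\<lambda>_. M))"
    using product_nn_integral_insert[of "{1..n}" "Suc n" "?q (Suc n)"] q_measurable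
    unfolding insert_eq by simp
  also have "\<dots> = (\<integral>\<^sup>+x. ?q n x \<partial>PiM {1..n} (\<lambda>_. M))"
  proof (rule nn_integral_cong)
    fix x assume x: "x \<in> space (PiM {1..n} (\<lambda>_. M))"
    let ?z = "lags p x (Suc n)" and ?\<theta> = "\<eta> (Suc n) (restrict x {1..n})"
    \<comment> \<open>The lags at time n + 1 lie in {1..n}; this is the boundary case t = n + 1 of
      \<open>measurable_lags\<close>.\<close>
    have z: "?z \<in> space (PiM {1..p} (\<lambda>_. M))"
      using measurable_space[OF measurable_lags x] step by simp
    have "restrict x {1..n} = x"
      using x by (auto simp: space_PiM PiE_restrict)
    then have \<theta>': "?\<theta> \<in> space N"
      using measurable_space[OF \<eta>[of "Suc n"]] x step by simp
    have "(\<lambda>y. (y, ?z, ?\<theta>)) \<in> measurable M (M \<Otimes>\<^sub>M PiM {1..p} (\<lambda>_. M) \<Otimes>\<^sub>M N)"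
      using z \<theta>' by (intro measurable_Pair) auto
    from measurable_compose[OF this conditional_measurable]
    have f_measurable: "(\<lambda>y. f y ?z ?\<theta>) \<in> borel_measurable M"
      by simp
    have "?q (Suc n) (x(Suc n := y)) = ?q n x * ennreal (f y ?z ?\<theta>)" for y
    proof -
      have "?q (Suc n) w
          = ?q n w * ennreal (f (w (Suc n)) (lags p w (Suc n)) (\<eta> (Suc n) (restrict w {1..n})))" for w
        using step by (simp add: mult_ac del: restrict_apply)
      \<comment> \<open>The factors up to n do not see y: their observations, lags and parameters
        all stop at coordinate n.\<close>
      moreover have "?q n (x(Suc n := y)) = ?q n x"
        using step
        by (intro arg_cong2[where f = "(*)"] prod.cong)
          (auto simp: lags_fun_upd restrict_fun_upd_outside fun_upd_other simp del: restrict_apply fun_upd_apply)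
      ultimately show ?thesis
        using step by (simp only: fun_upd_same lags_fun_upd[OF _ order_refl] le_imp_less_Suc)
          (simp add: restrict_fun_upd_outside)
    qed
    then have "(\<integral>\<^sup>+y. ?q (Suc n) (x(Suc n := y)) \<partial>M) = ?q n x * (\<integral>\<^sup>+y. ennreal (f y ?z ?\<theta>) \<partial>M)"
      using f_measurable by (simp add: nn_integral_cmult)
    then show "(\<integral>\<^sup>+y. ?q (Suc n) (x(Suc n := y)) \<partial>M) = ?q n x"
      using conditional_integral[OF \<theta>' z] by simp
  qed
  finally show ?case
    using step by simp
qed

lemma nn_integral_plug_in_density:
  assumes \<theta>: "\<theta> \<in> space N" and "p \<le> m" "m \<le> n"
    and \<theta>hat: "\<theta>hat \<in> measurable (PiM {1..m} (\<lambda>_. M)) N"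
  shows "(\<integral>\<^sup>+x. ennreal (joint_density p f\<^sub>0 f m \<theta> x * likelihood p f m n (\<theta>hat (restrict x {1..m})) x)
      \<partial>PiM {1..n} (\<lambda>_. M)) = 1"
proof -
  \<comment> \<open>Predictable in both cases: constant up to m, while for t > m the estimator reads
    only {1..m}, which lies in {1..t - 1}.\<close>
  define \<eta> where "\<eta> t y = (if t \<le> m then \<theta> else \<theta>hat (restrict y {1..m}))" for t y
  have \<eta>: "\<eta> t \<in> measurable (PiM {1..t - 1} (\<lambda>_. M)) N" for t
  proof (cases "t \<le> m")
    case True
    then show ?thesis
      using \<theta> unfolding \<eta>_def by simp
  next
    case False
    then have "(\<lambda>y. \<theta>hat (restrict y {1..m})) \<in> measurable (PiM {1..t - 1} (\<lambda>_. M)) N"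
      by (intro measurable_compose[OF measurable_restrict_atLeastAtMost \<theta>hat]) auto
    with False show ?thesis
      unfolding \<eta>_def by simp
  qed
  have "ennreal (joint_density p f\<^sub>0 f m \<theta> x * likelihood p f m n (\<theta>hat (restrict x {1..m})) x)
      = ennreal (f\<^sub>0 (restrict x {1..p}) \<theta>)
        * (\<Prod>t = p + 1..n. ennreal (f (x t) (lags p x t) (\<eta> t (restrict x {1..t - 1}))))"
    if x: "x \<in> space (PiM {1..n} (\<lambda>_. M))" for x
  proof -
    let ?g = "\<lambda>t. f (x t) (lags p x t) (\<eta> t (restrict x {1..t - 1}))"
    have g_nonneg: "0 \<le> ?g t" if t: "t \<in> {p + 1..n}" for t
    proof (rule conditional_density_nonneg[OF _ x])
      show "\<eta> t (restrict x {1..t - 1}) \<in> space N"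
        using t by (intro measurable_space[OF \<eta>]
            measurable_space[OF measurable_restrict_atLeastAtMost x]) auto
    qed (use t in auto)
    have f0_nonneg: "0 \<le> f\<^sub>0 (restrict x {1..p}) \<theta>"
      using assms by (intro initial_nonneg measurable_space[OF measurable_restrict_atLeastAtMost x]) auto
    have "(\<Prod>t = p + 1..m. f (x t) (lags p x t) \<theta>) = (\<Prod>t = p + 1..m. ?g t)"
      by (intro prod.cong) (auto simp: \<eta>_def)
    moreover have "likelihood p f m n (\<theta>hat (restrict x {1..m})) x = (\<Prod>t = m + 1..n. ?g t)"
      unfolding likelihood_def
    proof (intro prod.cong refl)
      fix t assume "t \<in> {m + 1..n}"
      \<comment> \<open>Restricting to {1..t - 1} before {1..m} loses nothing, as m \<le> t -
        1.\<close>
      then have "{1..t - 1} \<inter> {1..m} = {1..m}" "\<not> t \<le> m"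
        by auto
      then show "f (x t) (lags p x t) (\<theta>hat (restrict x {1..m})) = ?g t"
        by (simp add: \<eta>_def)
    qed
    moreover have "(\<Prod>t = p + 1..m. ?g t) * (\<Prod>t = m + 1..n. ?g t) = (\<Prod>t = p + 1..n. ?g t)"
      using \<open>p \<le> m\<close> \<open>m \<le> n\<close> prod.ub_add_nat[of "p + 1" m ?g "n - m"] by simp
    ultimately have "joint_density p f\<^sub>0 f m \<theta> x * likelihood p f m n (\<theta>hat (restrict x {1..m})) x
        = f\<^sub>0 (restrict x {1..p}) \<theta> * (\<Prod>t = p + 1..n. ?g t)"
      by (simp add: joint_density_def mult.assoc)
    \<comment> \<open>\<open>ennreal\<close> truncates negative reals to 0, so passing it through
      the products relies on the sign facts.\<close>
    then show ?thesis
      using f0_nonneg prod_nonneg[of "{p + 1..n}" ?g] g_nonneg prod_ennreal[of "{p + 1..n}" ?g]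
      by (simp only: ennreal_mult)
  qed
  from trans[OF nn_integral_cong[OF this] nn_integral_predictive_density[OF \<theta> _ \<eta>]]
  show ?thesis
    using assms(2,3) by simp
qed

text \<open>The factor up to m carries the same \<theta> as in the plug-in density, so comparing the
  two densities reduces to comparing likelihoods after m.\<close>

lemma joint_density_split:
  assumes "p \<le> m" "m \<le> n"
  shows "joint_density p f\<^sub>0 f n \<theta> x = joint_density p f\<^sub>0 f m \<theta> x * likelihood p f m n \<theta> x"
  using assms prod.ub_add_nat[of "p + 1" m "\<lambda>t. f (x t) (lags p x t) \<theta>" "n - m"]
  by (simp add: joint_density_def likelihood_def mult.assoc)

lemma joint_density_nonneg:
  assumes "\<theta> \<in> space N" "p \<le> m" "m \<le> n" "x \<in> space (PiM {1..n} (\<lambda>_. M))"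
  shows "0 \<le> joint_density p f\<^sub>0 f m \<theta> x"
  unfolding joint_density_def
  using assms
  by (intro mult_nonneg_nonneg prod_nonneg ballI conditional_density_nonneg initial_nonneg
      measurable_space[OF measurable_restrict_atLeastAtMost]) auto

lemma joint_density_measurable:
  assumes "\<theta> \<in> space N" "p \<le> n"
  shows "joint_density p f\<^sub>0 f n \<theta> \<in> borel_measurable (PiM {1..n} (\<lambda>_. M))"
  unfolding joint_density_def[abs_def]
  using assms
  by (intro borel_measurable_times borel_measurable_prod conditional_density_measurable
      initial_density_measurable) auto

end

section \<open>From a small p-value to an inequality between likelihoods\<close>

lemma p_value_le_imp_likelihood_le:
  assumes \<alpha>: "0 < \<alpha>" "\<alpha> < 1"
    and le: "p_value p f m n \<theta>hat \<theta>tilde x \<le> ennreal \<alpha>"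
    and max: "likelihood p f m n \<theta> x \<le> likelihood p f m n (\<theta>tilde x) x"
    and nonneg: "0 \<le> likelihood p f m n \<theta> x"
      "0 \<le> likelihood p f m n (\<theta>hat (restrict x {1..m})) x"
  shows "likelihood p f m n \<theta> x \<le> \<alpha> * likelihood p f m n (\<theta>hat (restrict x {1..m})) x"
proof (cases "likelihood p f m n (\<theta>tilde x) x = 0")
  \<comment> \<open>The ratio is infinite by convention and the p-value is 0, so \<open>le\<close>
    gives no information; but \<open>max\<close> and \<open>nonneg\<close> force the likelihood at
    \<theta> to be 0 as well.\<close>
  case True
  with max nonneg \<alpha> show ?thesis
    by simp
next
  case False
  let ?L = "likelihood p f m n (\<theta>tilde x) x"
    and ?K = "likelihood p f m n (\<theta>hat (restrict x {1..m})) x"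
  have L: "0 < ?L"
    using False max nonneg by simp
  have P: "p_value p f m n \<theta>hat \<theta>tilde x = 1 / ennreal (?K / ?L)"
    using False by (simp add: p_value_def split_statistic_def likelihood_ratio_def)
  \<comment> \<open>A vanishing numerator would give the ratio 0 and the p-value 1 / 0 =
    \<infinity>, contradicting \<open>le\<close>.\<close>
  have K: "0 < ?K"
  proof (rule ccontr)
    assume "\<not> 0 < ?K"
    with nonneg have "?K = 0"
      by simp
    with P le show False
      by (simp add: top_unique)
  qed
  have "1 / ennreal (?K / ?L) = ennreal (1 / (?K / ?L))"
    using K L by (subst divide_ennreal[symmetric]) auto
  with P le \<alpha> have "1 / (?K / ?L) \<le> \<alpha>"
    by simp
  with K have "?L \<le> \<alpha> * ?K"
    by (simp add: divide_simps)
  with max show ?thesis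
    by simp
qed

section \<open>Bounding the rejection probability under each null parameter\<close>

theorem proposition2:
  fixes M :: "'a measure" and N :: "'b measure" and \<Omega> :: "'w measure"
    and p T\<^sub>1 T :: nat
    and f\<^sub>0 :: "(nat \<Rightarrow> 'a) \<Rightarrow> 'b \<Rightarrow> real"
    and f :: "'a \<Rightarrow> (nat \<Rightarrow> 'a) \<Rightarrow> 'b \<Rightarrow> real"
    and Pr :: "'b \<Rightarrow> 'w measure"
    and X :: "nat \<Rightarrow> 'w \<Rightarrow> 'a"
    and \<Theta>\<^sub>0 :: "'b set"
    and \<theta>hat \<theta>tilde :: "(nat \<Rightarrow> 'a) \<Rightarrow> 'b"
    and \<alpha> :: real
  assumes "p \<le> T\<^sub>1" and "T\<^sub>1 < T"
    and "autoregressive_series M N p f\<^sub>0 f T \<Omega> Pr X"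
    and "\<Theta>\<^sub>0 \<subseteq> space N" and "\<Theta>\<^sub>0 \<noteq> {}"
    and "\<theta>hat \<in> measurable (PiM {1..T\<^sub>1} (\<lambda>_. M)) N"
    and "\<theta>tilde \<in> measurable (PiM {1..T} (\<lambda>_. M)) N"
    and "\<And>\<omega>. \<omega> \<in> space \<Omega> \<Longrightarrow>
      \<theta>tilde (observations X T \<omega>) \<in>
        {\<theta>' \<in> \<Theta>\<^sub>0. \<forall>\<theta>\<in>\<Theta>\<^sub>0. likelihood p f T\<^sub>1 T \<theta>' (observations X T \<omega>)
                          \<ge> likelihood p f T\<^sub>1 T \<theta> (observations X T \<omega>)}"
    and "0 < \<alpha>" and "\<alpha> < 1"
  shows "(SUP \<theta>\<in>\<Theta>\<^sub>0. measure (Pr \<theta>)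
    {\<omega> \<in> space \<Omega>. p_value p f T\<^sub>1 T \<theta>hat \<theta>tilde (observations X T \<omega>) \<le> ennreal \<alpha>}) \<le> \<alpha>"
proof (rule cSUP_least)
  interpret autoregressive_series M N p f\<^sub>0 f T \<Omega> Pr X
    by fact
  fix \<theta> assume \<theta>0: "\<theta> \<in> \<Theta>\<^sub>0"
  then have \<theta>: "\<theta> \<in> space N"
    using \<open>\<Theta>\<^sub>0 \<subseteq> space N\<close> by auto
  interpret prob_space "Pr \<theta>"
    using \<theta> by (rule prob_space_Pr)
  let ?P = "PiM {1..T} (\<lambda>_. M)"
  let ?hat = "\<lambda>x. \<theta>hat (restrict x {1..T\<^sub>1})"
  let ?L = "\<lambda>x. likelihood p f T\<^sub>1 T \<theta> x" and ?K = "\<lambda>x. likelihood p f T\<^sub>1 T (?hat x) x"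
  let ?J = "joint_density p f\<^sub>0 f T\<^sub>1 \<theta>"
  have dist: "distributed (Pr \<theta>) ?P (observations X T) (\<lambda>x. ennreal (joint_density p f\<^sub>0 f T \<theta> x))"
    using \<theta> by (rule distributed_observations)
  have obs: "observations X T \<in> measurable (Pr \<theta>) ?P"
    using distributed_measurable[OF dist] .
  have space_eq: "space (Pr \<theta>) = space \<Omega>"
    using sets_Pr[OF \<theta>] by (rule sets_eq_imp_space_eq)
  have hat: "?hat \<in> measurable ?P N"
    using \<open>T\<^sub>1 < T\<close>
    by (intro measurable_compose[OF measurable_restrict_atLeastAtMost \<open>\<theta>hat \<in> _\<close>]) simp
  have L_measurable: "?L \<in> borel_measurable ?P"
    using \<theta> \<open>p \<le> T\<^sub>1\<close> by (intro likelihood_measurable) auto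
  have K_measurable: "?K \<in> borel_measurable ?P"
    using hat \<open>p \<le> T\<^sub>1\<close> by (intro likelihood_measurable)
  have K_nonneg: "0 \<le> ?K x" if "x \<in> space ?P" for x
    using measurable_space[OF hat that] that \<open>p \<le> T\<^sub>1\<close> by (intro likelihood_nonneg)
  have J_nonneg: "0 \<le> ?J x" if "x \<in> space ?P" for x
    using that \<theta> \<open>p \<le> T\<^sub>1\<close> \<open>T\<^sub>1 < T\<close> by (intro joint_density_nonneg) auto
  have J_measurable: "?J \<in> borel_measurable ?P"
  proof -
    \<comment> \<open>\<open>?J\<close> reads only coordinates up to \<open>T\<^sub>1\<close>, so
      its measurability on the shorter product transfers to the longer one along the
      restriction.\<close>
    have "?J (restrict x {1..T\<^sub>1}) = ?J x" for x
      using \<open>p \<le> T\<^sub>1\<close> unfolding joint_density_def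
      by (intro arg_cong2[where f = "(*)"] prod.cong)
        (auto simp: lags_def Int_absorb1 intro!: arg_cong[where f = "\<lambda>z. f _ z \<theta>"] restrict_ext)
    with measurable_compose[OF measurable_restrict_atLeastAtMost joint_density_measurable[OF \<theta> \<open>p \<le> T\<^sub>1\<close>]]
    show ?thesis
      using \<open>T\<^sub>1 < T\<close> by simp
  qed
  \<comment> \<open>The maximiser \<open>\<theta>tilde\<close> does not occur in \<open>B\<close>,
    which compares the fixed \<theta> with the estimator only; its probability is then an integral
    of the joint density.\<close>
  define B where "B = {x \<in> space ?P. ?L x \<le> \<alpha> * ?K x}"
  have B: "B \<in> sets ?P"
    unfolding B_def using L_measurable K_measurable by measurable
  have "emeasure (Pr \<theta>) (observations X T -` B \<inter> space (Pr \<theta>))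
      = (\<integral>\<^sup>+x. ennreal (joint_density p f\<^sub>0 f T \<theta> x) * indicator B x \<partial>?P)"
    using distributed_emeasure[OF dist B] .
  \<comment> \<open>A Markov-type bound under the integral: on \<open>B\<close> the factor
    \<open>?L\<close> is replaced by \<alpha> times \<open>?K\<close>, with the nonnegative factor
    \<open>?J\<close> in common; off \<open>B\<close> the left side is 0.\<close>
  also have "\<dots> \<le> (\<integral>\<^sup>+x. ennreal \<alpha> * ennreal (?J x * ?K x) \<partial>?P)"
  proof (rule nn_integral_mono)
    fix x assume x: "x \<in> space ?P"
    show "ennreal (joint_density p f\<^sub>0 f T \<theta> x) * indicator B x \<le> ennreal \<alpha> * ennreal (?J x * ?K x)"
    proof (cases "x \<in> B")
      case True
      then have "?J x * ?L x \<le> ?J x * (\<alpha> * ?K x)"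
        using J_nonneg[OF x] by (intro mult_left_mono) (auto simp: B_def)
      then show ?thesis
        using True \<open>p \<le> T\<^sub>1\<close> \<open>T\<^sub>1 < T\<close> \<open>0 < \<alpha>\<close> J_nonneg[OF x] K_nonneg[OF x]
        by (simp add: joint_density_split[of T\<^sub>1 T] ennreal_mult[symmetric] mult.left_commute)
    qed simp
  qed
  also have "\<dots> = ennreal \<alpha> * (\<integral>\<^sup>+x. ennreal (?J x * ?K x) \<partial>?P)"
    using J_measurable K_measurable by (intro nn_integral_cmult) measurable
  also have "\<dots> = ennreal \<alpha>"
    using nn_integral_plug_in_density[OF \<theta> \<open>p \<le> T\<^sub>1\<close> _ \<open>\<theta>hat \<in> _\<close>, of T] \<open>T\<^sub>1 < T\<close> by simp
  finally have prob_B: "prob (observations X T -` B \<inter> space (Pr \<theta>)) \<le> \<alpha>"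
    using \<open>0 < \<alpha>\<close> by (simp add: emeasure_eq_measure)
  have "{\<omega> \<in> space \<Omega>. p_value p f T\<^sub>1 T \<theta>hat \<theta>tilde (observations X T \<omega>) \<le> ennreal \<alpha>}
      \<subseteq> observations X T -` B \<inter> space (Pr \<theta>)"
  proof
    fix \<omega> assume "\<omega> \<in> {\<omega> \<in> space \<Omega>. p_value p f T\<^sub>1 T \<theta>hat \<theta>tilde (observations X T \<omega>) \<le> ennreal \<alpha>}"
    then have \<omega>: "\<omega> \<in> space \<Omega>"
      and le: "p_value p f T\<^sub>1 T \<theta>hat \<theta>tilde (observations X T \<omega>) \<le> ennreal \<alpha>"
      by auto
    let ?x = "observations X T \<omega>"
    have x: "?x \<in> space ?P"
      using measurable_space[OF obs] \<omega> space_eq by simp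
    have "?L ?x \<le> \<alpha> * ?K ?x"
    proof (rule p_value_le_imp_likelihood_le[OF \<open>0 < \<alpha>\<close> \<open>\<alpha> < 1\<close> le])
      show "?L ?x \<le> likelihood p f T\<^sub>1 T (\<theta>tilde ?x) ?x"
        using assms(8)[OF \<omega>] \<theta>0 by simp
      show "0 \<le> ?L ?x"
        using \<open>p \<le> T\<^sub>1\<close> \<theta> x by (rule likelihood_nonneg)
    qed (rule K_nonneg[OF x])
    with x \<omega> show "\<omega> \<in> observations X T -` B \<inter> space (Pr \<theta>)"
      by (simp add: B_def space_eq)
  qed
  \<comment> \<open>Monotonicity asks for measurability of the larger event, which is the preimage
    of \<open>B\<close>.\<close>
  then have "prob {\<omega> \<in> space \<Omega>. p_value p f T\<^sub>1 T \<theta>hat \<theta>tilde (observations X T \<omega>) \<le> ennreal \<alpha>}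
      \<le> prob (observations X T -` B \<inter> space (Pr \<theta>))"
    using measurable_sets[OF obs B] by (intro finite_measure_mono)
  with prob_B show "prob {\<omega> \<in> space \<Omega>. p_value p f T\<^sub>1 T \<theta>hat \<theta>tilde (observations X T \<omega>) \<le> ennreal \<alpha>} \<le> \<alpha>"
    by linarith
qed (fact assms)

end
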